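(* Consider the linear programs $(\mathrm{TW})$, $(\mathrm{TWbnd})$, $(\mathrm{TWord})$, $(\mathrm{TWcomb})$ (single-row LP relaxations of the circle packing problem) defined in the context, and in each case let $\gamma^*$ denote the optimal (maximum) value of $\gamma$. (i) The optimal value of $(\mathrm{TW})$ is $\gamma^*=2$ for all $n\ge 2$. (ii) The optimal value of $(\mathrm{TWbnd})$ is $\gamma^*=\frac12$ for all $n\ge 5$. (iii) The optimal value of $(\mathrm{TWord})$ is $\gamma^*=1+\frac{1}{n-1}$ for all $n\ge 2$. (iv) The optimal value of $(\mathrm{TWcomb})$ is $\gamma^*=\frac14\Big(1+\frac{1}{\lfloor (n-1)/4\rfloor}\Big)$ for all $n\ge 5$.
   Context: Write $[n]=\{1,\dots,n\}$. The circle packing problem is: maximize $\gamma$ over $x,y\in[0,1]^n$, $\gamma\in\mathbb{R}$ subject to $(x_j-x_i)^2+(y_j-y_i)^2\ge\gamma$ for all $1\le i<j\le n$. For a convex set $D\subset\mathbb{R}^2$, let $e_D$ denote the concave envelope over $D$ of the function $(s,t)\mapsto (t-s)^2$, i.e. the pointwise smallest concave function on $D$ that is at least $(t-s)^2$ on $D$. For a box, $e_{[0,a]\times[0,b]}(s,t)=\min\{as+bt,\; 2ab+(a-2b)s+(b-2a)t\}$. Let $n_x=\lceil n/2\rceil$ and $n_y=\lceil n_x/2\rceil$. Put $u_i=\frac12$ for $1\le i\le n_x$ and $u_i=1$ for $n_x<i\le n$; put $v_i=\frac12$ for $1\le i\le n_y$ and $v_i=1$ for $n_y<i\le n$. In all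 problems below the variables are $x,y\in\mathbb{R}^n$ and $\gamma\in\mathbb{R}$, and $\gamma$ is maximized. $(\mathrm{TW})$: subject to $x,y\in[0,1]^n$ and, for all $1\le i<j\le n$, $x_i+x_j+y_i+y_j\ge\gamma$, $\;-x_i-x_j+y_i+y_j+2\ge\gamma$, $\;x_i+x_j-y_i-y_j+2\ge\gamma$, $\;-x_i-x_j-y_i-y_j+4\ge\gamma$. $(\mathrm{TWbnd})$: subject to $0\le x_i\le u_i$, $0\le y_i\le v_i$ for $i\in[n]$, and $e_{[0,u_i]\times[0,u_j]}(x_i,x_j)+e_{[0,v_i]\times[0,v_j]}(y_i,y_j)\ge\gamma$ for all $1\le i<j\le n$. $(\mathrm{TWord})$: subject to $0\le x_1\le\cdots\le x_n\le 1$, $y\in[0,1]^n$, and, for all $1\le i<j\le n$, $x_j-x_i+y_i+y_j\ge\gamma$ and $x_j-x_i-y_i-y_j+2\ge\gamma$. $(\mathrm{TWcomb})$: subject to $0\le x_i\le u_i$, $0\le y_i\le v_i$ for $i\in[n]$, $x_i\le x_{i+1}$ for all $i\in[n-1]\setminus\{n_y\}$, and $e_{D_{ij}}(x_i,x_j)+e_{[0,v_i]\times[0,v_j]}(y_i,y_j)\ge\gamma$ for all $1\le i<j\le n$. Here $D_{ij}$ is the (rectangular, triangular or trapezoidal) domain of $(x_i,x_j)$ given by the bounds and order constraints: $D_{ij}=\{(s,t): 0\le s\le u_i,\ 0\le t\le u_j,\ s\le t\}$ if $j\le n_y$ or $i>n_y$, and $D_{ij}=[0,u_i]\times[0,u_j]$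 if $i\le n_y<j$. *)

theory Defs
  imports "HOL-Analysis.Analysis"
begin

text \<open>
  A vector with \<open>n\<close> real components is a function of type \<^typ>\<open>nat \<Rightarrow> real\<close> of which only the values at the
  indices \<open>1, \<dots>, n\<close> are used.
\<close>

text \<open>
  The pointwise infimum of all concave majorants. For convex \<open>D\<close> and \<open>f\<close> bounded above on \<open>D\<close> it is
  the smallest one; see \<open>concave_envelope_least\<close> below.
\<close>

definition concave_envelope :: "'a::real_vector set \<Rightarrow> ('a \<Rightarrow> real) \<Rightarrow> 'a \<Rightarrow> real" where
  "concave_envelope D f p = Inf {g p | g. concave_on D g \<and> (\<forall>q\<in>D. f q \<le> g q)}"

lemma concave_envelope_least:
  fixes D :: "'a::real_vector set"
  assumes "convex D" and bdd: "\<And>q. q \<in> D \<Longrightarrow> f q \<le> B"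
  shows "concave_on D (concave_envelope D f)"
    and "\<And>p. p \<in> D \<Longrightarrow> f p \<le> concave_envelope D f p"
    and "\<And>g p. \<lbrakk>concave_on D g; \<forall>q\<in>D. f q \<le> g q; p \<in> D\<rbrakk> \<Longrightarrow> concave_envelope D f p \<le> g p"
proof -
  define M where "M p = {g p | g. concave_on D g \<and> (\<forall>q\<in>D. f q \<le> g q)}" for p
  have env: "concave_envelope D f p = Inf (M p)" for p
    by (simp add: concave_envelope_def M_def)
  have ne: "M p \<noteq> {}" for p
    using assms by (auto simp: M_def concave_on_const intro!: exI[of _ "\<lambda>_. B"])
  have lb: "bdd_below (M p)" if "p \<in> D" for p
    using that by (intro bdd_belowI[of _ "f p"]) (auto simp: M_def)
  show ge: "f p \<le> concave_envelope D f p" if "p \<in> D" for p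
    unfolding env using that ne by (intro cInf_greatest) (auto simp: M_def)
  show le: "concave_envelope D f p \<le> g p"
    if "concave_on D g" "\<forall>q\<in>D. f q \<le> g q" "p \<in> D" for g p
    unfolding env using that lb[of p] by (intro cInf_lower) (auto simp: M_def)
  show "concave_on D (concave_envelope D f)"
    unfolding concave_on_iff
  proof (intro conjI ballI allI impI \<open>convex D\<close>)
    fix p q and a b :: real
    assume pq: "p \<in> D" "q \<in> D" and ab: "0 \<le> a" "0 \<le> b" "a + b = 1"
    have "a * concave_envelope D f p + b * concave_envelope D f q \<le> m"
      if m_in: "m \<in> M (a *\<^sub>R p + b *\<^sub>R q)" for m
    proof -
      obtain g where g: "concave_on D g" "\<forall>q\<in>D. f q \<le> g q" and m: "m = g (a *\<^sub>R p + b *\<^sub>R q)"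
        using m_in unfolding M_def by blast
      have "a * concave_envelope D f p + b * concave_envelope D f q \<le> a * g p + b * g q"
        using le[OF g] pq ab by (intro add_mono mult_left_mono) auto
      also have "\<dots> \<le> m"
        using g(1) pq ab unfolding concave_on_iff m by blast
      finally show ?thesis .
    qed
    then show "a * concave_envelope D f p + b * concave_envelope D f q
        \<le> concave_envelope D f (a *\<^sub>R p + b *\<^sub>R q)"
      unfolding env[of "a *\<^sub>R p + b *\<^sub>R q"] using ne by (intro cInf_greatest)
  qed
qed

definition e_env :: "(real \<times> real) set \<Rightarrow> real \<Rightarrow> real \<Rightarrow> real" where
  "e_env D s t = concave_envelope D (\<lambda>(s, t). (t - s)\<^sup>2) (s, t)"

definition n_x :: "nat \<Rightarrow> nat" where
  "n_x n = nat \<lceil>real n / 2\<rceil>"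

definition n_y :: "nat \<Rightarrow> nat" where
  "n_y n = nat \<lceil>real (n_x n) / 2\<rceil>"

definition u_bnd :: "nat \<Rightarrow> nat \<Rightarrow> real" where
  "u_bnd n i = (if i \<le> n_x n then 1/2 else 1)"

definition v_bnd :: "nat \<Rightarrow> nat \<Rightarrow> real" where
  "v_bnd n i = (if i \<le> n_y n then 1/2 else 1)"

definition D_comb :: "nat \<Rightarrow> nat \<Rightarrow> nat \<Rightarrow> (real \<times> real) set" where
  "D_comb n i j =
     (if j \<le> n_y n \<or> n_y n < i
      then {(s, t). 0 \<le> s \<and> s \<le> u_bnd n i \<and> 0 \<le> t \<and> t \<le> u_bnd n j \<and> s \<le> t}
      else {0..u_bnd n i} \<times> {0..u_bnd n j})"

definition TW :: "nat \<Rightarrow> (nat \<Rightarrow> real) \<Rightarrow> (nat \<Rightarrow> real) \<Rightarrow> real \<Rightarrow> bool" where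
  "TW n x y \<gamma> \<longleftrightarrow>
     (\<forall>i\<in>{1..n}. x i \<in> {0..1} \<and> y i \<in> {0..1}) \<and>
     (\<forall>i\<in>{1..n}. \<forall>j\<in>{1..n}. i < j \<longrightarrow>
        x i + x j + y i + y j \<ge> \<gamma> \<and>
        - x i - x j + y i + y j + 2 \<ge> \<gamma> \<and>
        x i + x j - y i - y j + 2 \<ge> \<gamma> \<and>
        - x i - x j - y i - y j + 4 \<ge> \<gamma>)"

definition TWbnd :: "nat \<Rightarrow> (nat \<Rightarrow> real) \<Rightarrow> (nat \<Rightarrow> real) \<Rightarrow> real \<Rightarrow> bool" where
  "TWbnd n x y \<gamma> \<longleftrightarrow>
     (\<forall>i\<in>{1..n}. 0 \<le> x i \<and> x i \<le> u_bnd n i \<and> 0 \<le> y i \<and> y i \<le> v_bnd n i) \<and>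
     (\<forall>i\<in>{1..n}. \<forall>j\<in>{1..n}. i < j \<longrightarrow>
        e_env ({0..u_bnd n i} \<times> {0..u_bnd n j}) (x i) (x j) + e_env ({0..v_bnd n i} \<times> {0..v_bnd n j}) (y i) (y j) \<ge> \<gamma>)"

definition TWord :: "nat \<Rightarrow> (nat \<Rightarrow> real) \<Rightarrow> (nat \<Rightarrow> real) \<Rightarrow> real \<Rightarrow> bool" where
  "TWord n x y \<gamma> \<longleftrightarrow>
     0 \<le> x 1 \<and> (\<forall>i\<in>{1..<n}. x i \<le> x (i + 1)) \<and> x n \<le> 1 \<and>
     (\<forall>i\<in>{1..n}. y i \<in> {0..1}) \<and>
     (\<forall>i\<in>{1..n}. \<forall>j\<in>{1..n}. i < j \<longrightarrow>
        x j - x i + y i + y j \<ge> \<gamma> \<and>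
        x j - x i - y i - y j + 2 \<ge> \<gamma>)"

definition TWcomb :: "nat \<Rightarrow> (nat \<Rightarrow> real) \<Rightarrow> (nat \<Rightarrow> real) \<Rightarrow> real \<Rightarrow> bool" where
  "TWcomb n x y \<gamma> \<longleftrightarrow>
     (\<forall>i\<in>{1..n}. 0 \<le> x i \<and> x i \<le> u_bnd n i \<and> 0 \<le> y i \<and> y i \<le> v_bnd n i) \<and>
     (\<forall>i\<in>{1..<n} - {n_y n}. x i \<le> x (i + 1)) \<and>
     (\<forall>i\<in>{1..n}. \<forall>j\<in>{1..n}. i < j \<longrightarrow>
        e_env (D_comb n i j) (x i) (x j) + e_env ({0..v_bnd n i} \<times> {0..v_bnd n j}) (y i) (y j) \<ge> \<gamma>)"

text \<open>The maximum of \<open>\<gamma>\<close> over the feasible triples \<open>(x, y, \<gamma>)\<close>; attainment is part of the claim.\<close>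

definition is_optimal_value ::
    "((nat \<Rightarrow> real) \<Rightarrow> (nat \<Rightarrow> real) \<Rightarrow> real \<Rightarrow> bool) \<Rightarrow> real \<Rightarrow> bool" where
  "is_optimal_value feasible \<gamma>' \<longleftrightarrow>
     (\<exists>x y. feasible x y \<gamma>') \<and> (\<forall>x y \<gamma>. feasible x y \<gamma> \<longrightarrow> \<gamma> \<le> \<gamma>')"

end

theory Submission
  imports Defs
begin

text \<open>
  Upper bounds: averaging over constraints eliminates \<open>y\<close>, and for (TWord) and (TWcomb) the
  resulting bounds for consecutive indices telescope in \<open>x\<close>; for (TWcomb) only the indices
  \<open>i \<le> n\<^sub>y = \<lfloor>(n - 1) / 4\<rfloor> + 1\<close> matter, where the envelope over the triangle
  \<open>0 \<le> s \<le> t \<le> 1/2\<close> is \<open>(t - s) / 2\<close>.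
  Lower bounds: put each coordinate at the middle of its range, or equidistantly if it is subject
  to active order constraints; for (TWcomb), all indices above \<open>n\<^sub>y\<close> take \<open>x = 0\<close>,
  since the \<open>y\<close>-envelope alone is then at least \<open>1/2\<close>.
\<close>

section \<open>Envelopes of the squared difference inside the unit square\<close>

lemma square_diff_le_1:
  assumes "D \<subseteq> {0..1} \<times> {0..1::real}" "q \<in> D"
  shows "(case q of (s, t) \<Rightarrow> (t - s)\<^sup>2) \<le> 1"
proof -
  obtain s t where q: "q = (s, t)" by force
  have "0 \<le> s" "s \<le> 1" "0 \<le> t" "t \<le> 1" using assms unfolding q by auto
  then have "\<bar>t - s\<bar> \<le> 1" by linarith
  then show ?thesis by (simp add: q abs_square_le_1)
qed

lemma e_env_ge_square:
  assumes "convex D" "D \<subseteq> {0..1} \<times> {0..1}" "(s, t) \<in> D"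
  shows "(t - s)\<^sup>2 \<le> e_env D s t"
  using concave_envelope_least(2)[where f = "\<lambda>(s, t). (t - s)\<^sup>2" and p = "(s, t)",
      OF assms(1) square_diff_le_1[OF assms(2)]] assms(3)
  by (simp add: e_env_def)

text \<open>The envelope is concave and dominates the square at both endpoints, so the chord through
  these two values lies below it. Lower bounds then need only two well-chosen points, no closed
  form.\<close>

lemma e_env_ge_chord:
  assumes D: "convex D" "D \<subseteq> {0..1} \<times> {0..1}" and pq: "(s, t) \<in> D" "(s', t') \<in> D"
    and d: "0 \<le> d" "d \<le> 1"
  shows "(1 - d) * (t - s)\<^sup>2 + d * (t' - s')\<^sup>2
           \<le> e_env D ((1 - d) * s + d * s') ((1 - d) * t + d * t')"
proof -
  have "concave_on D (concave_envelope D (\<lambda>(s, t). (t - s)\<^sup>2))"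
    using D by (intro concave_envelope_least(1)[where B = 1] square_diff_le_1) auto
  from concave_onD[OF this d pq]
  have "(1 - d) * e_env D s t + d * e_env D s' t'
          \<le> e_env D ((1 - d) * s + d * s') ((1 - d) * t + d * t')"
    by (simp add: e_env_def)
  moreover have "(1 - d) * (t - s)\<^sup>2 + d * (t' - s')\<^sup>2 \<le> (1 - d) * e_env D s t + d * e_env D s' t'"
    using assms by (intro add_mono mult_left_mono e_env_ge_square) auto
  ultimately show ?thesis by linarith
qed

text \<open>An affine majorant is concave, hence a competitor in the infimum that defines the
  envelope.\<close>

lemma e_env_le_affine:
  assumes D: "convex D" "D \<subseteq> {0..1} \<times> {0..1}" and p: "(s, t) \<in> D"
    and le: "\<And>s t. (s, t) \<in> D \<Longrightarrow> (t - s)\<^sup>2 \<le> a * s + b * t + c"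
  shows "e_env D s t \<le> a * s + b * t + c"
proof -
  have "concave_on D (\<lambda>p. a * fst p + b * snd p + c)"
    unfolding concave_on_iff
  proof (intro conjI ballI allI impI D)
    fix p q :: "real \<times> real" and u v :: real
    assume "u + v = 1"
    then have "c = u * c + v * c" by (metis distrib_right mult_1)
    then show "u * (a * fst p + b * snd p + c) + v * (a * fst q + b * snd q + c)
        \<le> a * fst (u *\<^sub>R p + v *\<^sub>R q) + b * snd (u *\<^sub>R p + v *\<^sub>R q) + c"
      by (simp add: algebra_simps)
  qed
  from concave_envelope_least(3)[where f = "\<lambda>(s, t). (t - s)\<^sup>2",
      OF D(1) square_diff_le_1[OF D(2)] this _ p]
  show ?thesis using le unfolding e_env_def by fastforce
qed

text \<open>The centre is the midpoint of the corners \<open>(a, 0)\<close> and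
  \<open>(0, b)\<close>, where the square takes the values \<open>a\<^sup>2\<close> and
  \<open>b\<^sup>2\<close>.\<close>

lemma e_env_box_centre:
  assumes "0 \<le> a" "a \<le> 1" "0 \<le> b" "b \<le> 1"
  shows "(a\<^sup>2 + b\<^sup>2) / 2 \<le> e_env ({0..a} \<times> {0..b}) (a / 2) (b / 2)"
proof -
  have "convex ({0..a} \<times> {0..b})" "{0..a} \<times> {0..b} \<subseteq> {0..1} \<times> {0..1}"
    using assms by (auto simp: convex_Times)
  from e_env_ge_chord[OF this, of a 0 0 b "1 / 2"] assms show ?thesis
    by (simp add: field_simps)
qed

text \<open>The affine majorants \<open>(s + t) / 2\<close> and \<open>(1 - s - t) / 2\<close> add
  up to the constant 1/2, so one of them is at most 1/4. Both majorize because
  \<open>\<bar>t - s\<bar>\<close> is at most 1/2, at most \<open>s + t\<close> and at most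
  \<open>1 - s - t\<close>.\<close>

lemma e_env_half_square_le:
  assumes "s \<in> {0..1/2}" "t \<in> {0..1/2}"
  shows "e_env ({0..1/2} \<times> {0..1/2}) s t \<le> 1 / 4"
proof -
  have low: "(t - s)\<^sup>2 \<le> 1/2 * s + 1/2 * t + 0"
    and high: "(t - s)\<^sup>2 \<le> (- 1/2) * s + (- 1/2) * t + 1/2"
    if "(s, t) \<in> {0..1/2} \<times> {0..1/2::real}" for s t
  proof -
    have "0 \<le> s" "s \<le> 1/2" "0 \<le> t" "t \<le> 1/2" using that by auto
    then have "\<bar>t - s\<bar> \<le> 1/2" by linarith
    then have "\<bar>t - s\<bar> * \<bar>t - s\<bar> \<le> 1/2 * \<bar>t - s\<bar>"
      by (rule mult_right_mono) simp
    then have "(t - s)\<^sup>2 \<le> 1/2 * \<bar>t - s\<bar>"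
      by (simp add: power2_eq_square)
    with that show "(t - s)\<^sup>2 \<le> 1/2 * s + 1/2 * t + 0"
      and "(t - s)\<^sup>2 \<le> (- 1/2) * s + (- 1/2) * t + 1/2"
      by auto
  qed
  let ?D = "{0..1/2::real} \<times> {0..1/2::real}"
  have D: "convex ?D" "?D \<subseteq> {0..1} \<times> {0..1}" "(s, t) \<in> ?D"
    using assms by (auto simp: convex_Times)
  show ?thesis
    using e_env_le_affine[OF D low] e_env_le_affine[OF D high] by linarith
qed

text \<open>Kept in the shape of \<open>D_comb\<close>, whose value it is for
  \<open>i < j \<le> n_y n\<close>.\<close>

definition half_triangle :: "(real \<times> real) set" where
  "half_triangle = {(s, t). 0 \<le> s \<and> s \<le> 1/2 \<and> 0 \<le> t \<and> t \<le> 1/2 \<and> s \<le> t}"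

lemma convex_box_below_diagonal:
  "convex {(s, t). 0 \<le> s \<and> s \<le> a \<and> 0 \<le> t \<and> t \<le> b \<and> s \<le> (t::real)}"
proof -
  have "convex (({0..a} \<times> {0..b}) \<inter> {p. inner (1, - 1) p \<le> 0})"
    by (intro convex_Int convex_Times convex_real_interval convex_halfspace_le)
  also have "({0..a} \<times> {0..b}) \<inter> {p. inner (1, - 1) p \<le> 0}
      = {(s, t). 0 \<le> s \<and> s \<le> a \<and> 0 \<le> t \<and> t \<le> b \<and> s \<le> t}"
    by auto
  finally show ?thesis .
qed

text \<open>On the triangle \<open>0 \<le> t - s \<le> 1/2\<close>, so \<open>(t - s) / 2\<close>
  majorizes the square; the two agree on the diagonal and at the corner \<open>(0, 1/2)\<close>,
  which makes the majorant tight.\<close>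

lemma e_env_half_triangle:
  assumes st: "(s, t) \<in> half_triangle"
  shows "e_env half_triangle s t = (t - s) / 2"
proof (rule antisym)
  have D: "convex half_triangle" "half_triangle \<subseteq> {0..1} \<times> {0..1}"
    unfolding half_triangle_def by (rule convex_box_below_diagonal) auto
  have "(t - s)\<^sup>2 \<le> (- 1/2) * s + 1/2 * t + 0" if "(s, t) \<in> half_triangle" for s t
    using mult_right_mono[of "t - s" "1/2" "t - s"] that
    by (auto simp: half_triangle_def power2_eq_square)
  from e_env_le_affine[OF D st this] show "e_env half_triangle s t \<le> (t - s) / 2"
    by (simp add: field_simps)
  \<comment> \<open>\<open>(s, t)\<close> lies on the chord from \<open>(q, q)\<close> to the corner \<open>(0, 1/2)\<close>; for \<open>d = 1\<close> the junk value
    \<open>q = 0\<close> is harmless.\<close>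
  define d where "d = 2 * (t - s)"
  define q where "q = s / (1 - d)"
  have d: "0 \<le> d" "d \<le> 1" using st by (auto simp: d_def half_triangle_def)
  have s: "(1 - d) * q = s"
    using st by (cases "d = 1") (auto simp: q_def d_def half_triangle_def)
  have t: "s + d * (1/2) = t" by (simp add: d_def field_simps)
  \<comment> \<open>The second inequality is \<open>t \<le> 1/2\<close> rewritten; divided by
    \<open>1 - d\<close> it gives \<open>q \<le> 1/2\<close>.\<close>
  have "0 \<le> s" "s \<le> (1 - d) * (1/2)" using st by (auto simp: d_def half_triangle_def field_simps)
  then have "(q, q) \<in> half_triangle"
    using d by (cases "d = 1") (auto simp: q_def half_triangle_def divide_simps mult.commute)
  moreover have "(0, 1/2) \<in> half_triangle" by (simp add: half_triangle_def)
  ultimately have "(1 - d) * (q - q)\<^sup>2 + d * (1/2 - 0)\<^sup>2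
      \<le> e_env half_triangle ((1 - d) * q + d * 0) ((1 - d) * q + d * (1/2))"
    using d by (intro e_env_ge_chord D)
  then have "(1 - d) * (q - q)\<^sup>2 + d * (1/2 - 0)\<^sup>2 \<le> e_env half_triangle s t"
    by (simp only: s t mult_zero_right add_0_right)
  then show "(t - s) / 2 \<le> e_env half_triangle s t"
    by (simp add: d_def power2_eq_square)
qed

section \<open>Index thresholds and variable bounds\<close>

lemma nat_ceiling_half: "nat \<lceil>real n / 2\<rceil> = (n + 1) div 2"
proof -
  define k where "k = (n + 1) div 2"
  have "n \<le> 2 * k" "2 * k \<le> n + 1" unfolding k_def by presburger+
  then have "\<lceil>real n / 2\<rceil> = int k" by (intro ceiling_unique) auto
  then show ?thesis by (simp add: k_def)
qed

lemma n_y_eq: "n_y n = (n + 3) div 4"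
  unfolding n_y_def n_x_def nat_ceiling_half by presburger

lemma n_y_le_n_x: "n_y n \<le> n_x n"
  unfolding n_y_def nat_ceiling_half by (cases "n_x n") auto

lemma bnd_bounds: "1/2 \<le> u_bnd n i" "u_bnd n i \<le> 1" "1/2 \<le> v_bnd n i" "v_bnd n i \<le> 1"
  by (auto simp: u_bnd_def v_bnd_def)

lemma u_bnd_half: "i \<le> n_y n \<Longrightarrow> u_bnd n i = 1/2"
  using n_y_le_n_x[of n] by (simp add: u_bnd_def)

lemma v_bnd_half: "i \<le> n_y n \<Longrightarrow> v_bnd n i = 1/2"
  by (simp add: v_bnd_def)

section \<open>Optimal values of the four programs\<close>

lemma TW_optimal:
  assumes "2 \<le> n"
  shows "is_optimal_value (TW n) 2"
  unfolding is_optimal_value_def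
proof (intro conjI allI impI)
  show "\<exists>x y. TW n x y 2"
    by (intro exI[of _ "\<lambda>_. 1/2"]) (auto simp: TW_def)
  fix x y \<gamma> assume "TW n x y \<gamma>"
  moreover have "1 \<in> {1..n}" "2 \<in> {1..n}" "(1::nat) < 2" using assms by auto
  \<comment> \<open>These two constraints of a single pair sum to
    \<open>2 * \<gamma> \<le> 4\<close>.\<close>
  ultimately have "x 1 + x 2 + y 1 + y 2 \<ge> \<gamma>" "- x 1 - x 2 - y 1 - y 2 + 4 \<ge> \<gamma>"
    unfolding TW_def by blast+
  then show "\<gamma> \<le> 2" by linarith
qed

lemma TWbnd_optimal:
  assumes "5 \<le> n"
  shows "is_optimal_value (TWbnd n) (1/2)"
  unfolding is_optimal_value_def
proof (intro conjI allI impI)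
  have quarter: "1/4 \<le> e_env ({0..a} \<times> {0..b}) (a / 2) (b / 2)"
    if "1/2 \<le> a" "a \<le> 1" "1/2 \<le> b" "b \<le> 1" for a b :: real
    using e_env_box_centre[of a b] power_mono[of "1/2" a 2] power_mono[of "1/2" b 2] that
    by (simp add: power2_eq_square)
  \<comment> \<open>The value 1/2 is split as \<open>1/4 + 1/4\<close> so that
    \<open>add_mono\<close> treats the two envelopes separately.\<close>
  have "TWbnd n (\<lambda>i. u_bnd n i / 2) (\<lambda>i. v_bnd n i / 2) (1/4 + 1/4)"
    unfolding TWbnd_def
  proof (intro conjI ballI impI add_mono quarter)
  qed (auto simp: bnd_bounds u_bnd_def v_bnd_def)
  then show "\<exists>x y. TWbnd n x y (1/2)" by auto
  fix x y \<gamma> assume tw: "TWbnd n x y \<gamma>"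
  \<comment> \<open>From \<open>n = 5\<close> on, the pair (1, 2) has all four bounds equal to 1/2,
    and this pair alone limits \<gamma>.\<close>
  have "2 \<le> n_y n" using assms by (simp add: n_y_eq)
  then have bnds: "u_bnd n 1 = 1/2" "u_bnd n 2 = 1/2" "v_bnd n 1 = 1/2" "v_bnd n 2 = 1/2"
    by (auto simp: u_bnd_half v_bnd_half)
  have mem: "1 \<in> {1..n}" "2 \<in> {1..n}" "(1::nat) < 2" using assms by auto
  then have "x 1 \<in> {0..u_bnd n 1}" "x 2 \<in> {0..u_bnd n 2}"
    "y 1 \<in> {0..v_bnd n 1}" "y 2 \<in> {0..v_bnd n 2}"
    using tw unfolding TWbnd_def by auto
  moreover have "\<gamma> \<le> e_env ({0..u_bnd n 1} \<times> {0..u_bnd n 2}) (x 1) (x 2)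
      + e_env ({0..v_bnd n 1} \<times> {0..v_bnd n 2}) (y 1) (y 2)"
    using tw mem unfolding TWbnd_def by blast
  ultimately have "x 1 \<in> {0..1/2}" "x 2 \<in> {0..1/2}" "y 1 \<in> {0..1/2}" "y 2 \<in> {0..1/2}"
    and "\<gamma> \<le> e_env ({0..1/2} \<times> {0..1/2}) (x 1) (x 2) + e_env ({0..1/2} \<times> {0..1/2}) (y 1) (y 2)"
    unfolding bnds by blast+
  with e_env_half_square_le[of "x 1" "x 2"] e_env_half_square_le[of "y 1" "y 2"]
  show "\<gamma> \<le> 1/2" by linarith
qed

lemma le_of_increments:
  fixes x :: "nat \<Rightarrow> real"
  assumes "\<And>i. i \<in> {1..m} \<Longrightarrow> c \<le> x (i + 1) - x i"
  shows "real m * c \<le> x (m + 1) - x 1"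
  using assms
proof (induction m)
  case (Suc m)
  from Suc.IH Suc.prems have "real m * c \<le> x (m + 1) - x 1" by simp
  moreover have "c \<le> x (Suc m + 1) - x (m + 1)" using Suc.prems[of "Suc m"] by simp
  ultimately show ?case by (simp add: algebra_simps)
qed simp

lemma TWord_optimal:
  assumes n: "2 \<le> n"
  shows "is_optimal_value (TWord n) (1 + 1 / (real n - 1))"
  unfolding is_optimal_value_def
proof (intro conjI allI impI)
  define x where "x i = (real i - 1) / (real n - 1)" for i
  have "1 / (real n - 1) \<le> x j - x i" if "i < j" for i j
    using that n by (simp add: x_def diff_divide_distrib[symmetric] divide_right_mono)
  then have "TWord n x (\<lambda>_. 1/2) (1 + 1 / (real n - 1))"
    unfolding TWord_def using n by (auto simp: x_def divide_right_mono)
  then show "\<exists>x y. TWord n x y (1 + 1 / (real n - 1))" by blast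
  fix x y \<gamma> assume tw: "TWord n x y \<gamma>"
  \<comment> \<open>Averaging the two constraints of a consecutive pair cancels
    \<open>y\<close>.\<close>
  have "\<gamma> - 1 \<le> x (i + 1) - x i" if "i \<in> {1..n - 1}" for i
  proof -
    have "i \<in> {1..n}" "i + 1 \<in> {1..n}" "i < i + 1" using that n by auto
    with tw have "x (i + 1) - x i + y i + y (i + 1) \<ge> \<gamma>"
      "x (i + 1) - x i - y i - y (i + 1) + 2 \<ge> \<gamma>"
      unfolding TWord_def by blast+
    then show ?thesis by linarith
  qed
  from le_of_increments[where x = x and m = "n - 1", OF this]
  have "real (n - 1) * (\<gamma> - 1) \<le> x n - x 1"
    using n by simp
  also have "\<dots> \<le> 1" using tw by (simp add: TWord_def)
  finally show "\<gamma> \<le> 1 + 1 / (real n - 1)"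
    using n by (simp add: field_simps)
qed

lemma D_comb_half_triangle: "i < j \<Longrightarrow> j \<le> n_y n \<Longrightarrow> D_comb n i j = half_triangle"
  by (simp add: D_comb_def half_triangle_def u_bnd_half)

lemma convex_D_comb: "convex (D_comb n i j)"
  by (auto simp: D_comb_def convex_box_below_diagonal convex_Times)

lemma D_comb_subset: "D_comb n i j \<subseteq> {0..1} \<times> {0..1}"
  using bnd_bounds(2)[of n i] bnd_bounds(2)[of n j]
  by (auto simp: D_comb_def split: if_splits)

lemma TWcomb_optimal:
  assumes n: "5 \<le> n"
  shows "is_optimal_value (TWcomb n) (1/4 * (1 + 1 / real_of_int \<lfloor>(real n - 1) / 4\<rfloor>))"
proof -
  define m where "m = (n - 1) div 4"
  have fl: "real_of_int \<lfloor>(real n - 1) / 4\<rfloor> = real m"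
  proof -
    have "4 * m \<le> n - 1" "n - 1 < 4 * m + 4" unfolding m_def by presburger+
    with n have "\<lfloor>(real n - 1) / 4\<rfloor> = int m" by (intro floor_unique) auto
    then show ?thesis by simp
  qed
  have m: "1 \<le> m" and ny: "n_y n = m + 1" and nyn: "m + 1 \<le> n"
    using n by (auto simp: m_def n_y_eq)
  show ?thesis
    unfolding is_optimal_value_def fl
  proof (intro conjI allI impI)
    \<comment> \<open>The first \<open>m + 1\<close> points fill [0, 1/2] with spacing
      \<open>1 / (2 * m)\<close>. The drop to 0 after them is allowed, since no order constraint
      links \<open>n_y n = m + 1\<close> to its successor.\<close>
    define x where "x i = (if i \<le> m + 1 then (real i - 1) / (2 * real m) else 0)" for i
    let ?y = "\<lambda>i. v_bnd n i / 2"
    have x_le: "x i \<le> 1/2" if "i \<in> {1..n}" for i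
      using that m by (auto simp: x_def field_simps)
    have x_ge: "0 \<le> x i" if "i \<in> {1..n}" for i
      using that m by (auto simp: x_def)
    have step: "1 / (2 * real m) \<le> x j - x i" if "i < j" "j \<le> m + 1" for i j
      using that m by (simp add: x_def diff_divide_distrib[symmetric] divide_right_mono)
    have "TWcomb n x ?y (1/4 * (1 + 1 / real m))"
      unfolding TWcomb_def
    proof (intro conjI ballI impI)
      fix i assume i: "i \<in> {1..n}"
      show "0 \<le> x i" using x_ge[OF i] .
      show "x i \<le> u_bnd n i" using x_le[OF i] bnd_bounds(1)[of n i] by linarith
      show "0 \<le> ?y i" "?y i \<le> v_bnd n i" using bnd_bounds(3)[of n i] by auto
    next
      fix i assume "i \<in> {1..<n} - {n_y n}"
      then show "x i \<le> x (i + 1)"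
        by (auto simp: x_def ny divide_right_mono)
    next
      fix i j assume ij: "i \<in> {1..n}" "j \<in> {1..n}" "i < j"
      have ey: "((v_bnd n i)\<^sup>2 + (v_bnd n j)\<^sup>2) / 2
          \<le> e_env ({0..v_bnd n i} \<times> {0..v_bnd n j}) (?y i) (?y j)"
        using bnd_bounds(3,4)[of n i] bnd_bounds(3,4)[of n j]
        by (intro e_env_box_centre) auto
      show "e_env (D_comb n i j) (x i) (x j)
          + e_env ({0..v_bnd n i} \<times> {0..v_bnd n j}) (?y i) (?y j) \<ge> 1/4 * (1 + 1 / real m)"
      proof (cases "j \<le> m + 1")
        case True
        have "0 \<le> 1 / (2 * real m)" by simp
        with step[OF ij(3) True] have "x i \<le> x j" by linarith
        with x_ge x_le ij have "(x i, x j) \<in> half_triangle" by (auto simp: half_triangle_def)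
        then have "e_env (D_comb n i j) (x i) (x j) = (x j - x i) / 2"
          using ij True by (simp add: D_comb_half_triangle ny e_env_half_triangle)
        moreover have "i \<le> n_y n" "j \<le> n_y n" using ij True by (auto simp: ny)
        then have "((v_bnd n i)\<^sup>2 + (v_bnd n j)\<^sup>2) / 2 = 1/4"
          by (simp add: v_bnd_half power2_eq_square)
        ultimately have "1/4 + (x j - x i) / 2 \<le> e_env (D_comb n i j) (x i) (x j)
            + e_env ({0..v_bnd n i} \<times> {0..v_bnd n j}) (?y i) (?y j)"
          using ey by linarith
        moreover have "1/4 * (1 + 1 / real m) \<le> 1/4 + (x j - x i) / 2"
          using step[OF ij(3) True] by (simp add: field_simps)
        ultimately show ?thesis by linarith
      next
        case False
        \<comment> \<open>Here \<open>j > n_y n\<close>: for \<open>i \<le> n_y n\<close> the domain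
          is a box, and otherwise both coordinates are 0, so the order holds.\<close>
        have "(x i, x j) \<in> D_comb n i j"
        proof -
          have "x k \<in> {0..u_bnd n k}" if "k \<in> {1..n}" for k
            using x_ge[OF that] x_le[OF that] bnd_bounds(1)[of n k] by simp
          moreover have "x i \<le> x j" if "n_y n < i"
            using that ij by (simp add: x_def ny)
          ultimately show ?thesis using ij False by (auto simp: D_comb_def ny)
        qed
        from e_env_ge_square[OF convex_D_comb D_comb_subset this]
        have "0 \<le> e_env (D_comb n i j) (x i) (x j)"
          using zero_le_power2[of "x j - x i"] by linarith
        moreover have "v_bnd n j = 1" using False by (simp add: v_bnd_def ny)
        then have "1/2 \<le> ((v_bnd n i)\<^sup>2 + (v_bnd n j)\<^sup>2) / 2" by simp
        \<comment> \<open>Here \<open>m \<ge> 1\<close>, that is \<open>n \<ge> 5\<close>, lets the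
          \<open>y\<close>-envelope suffice on its own.\<close>
        moreover have "1/4 * (1 + 1 / real m) \<le> 1/2" using m by (simp add: field_simps)
        ultimately show ?thesis using ey by linarith
      qed
    qed
    then show "\<exists>x y. TWcomb n x y (1/4 * (1 + 1 / real m))" by blast
  next
    fix x y \<gamma> assume tw: "TWcomb n x y \<gamma>"
    have bnds: "x i \<in> {0..1/2} \<and> y i \<in> {0..1/2}" if "i \<in> {1..m + 1}" for i
    proof -
      have "i \<in> {1..n}" "i \<le> n_y n" using that nyn ny by auto
      with tw show ?thesis
        unfolding TWcomb_def by (auto dest!: bspec[of _ _ i] simp: u_bnd_half v_bnd_half)
    qed
    \<comment> \<open>This is \<open>\<gamma> \<le> (x (i + 1) - x i) / 2 + 1/4\<close> solved for
      the increment. As \<open>i + 1 \<le> m + 1 = n_y n\<close>, both indices have bounds 1/2; the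
      \<open>m\<close> increments then telescope within [0, 1/2].\<close>
    have "2 * \<gamma> - 1/2 \<le> x (i + 1) - x i" if i: "i \<in> {1..m}" for i
    proof -
      have mem: "i \<in> {1..n}" "i + 1 \<in> {1..n}" "i < i + 1" "i \<in> {1..<n} - {n_y n}"
        using i nyn ny by auto
      then have le: "x i \<le> x (i + 1)"
        and "\<gamma> \<le> e_env (D_comb n i (i + 1)) (x i) (x (i + 1))
          + e_env ({0..v_bnd n i} \<times> {0..v_bnd n (i + 1)}) (y i) (y (i + 1))"
        using tw unfolding TWcomb_def by blast+
      moreover have eq: "D_comb n i (i + 1) = half_triangle" "v_bnd n i = 1/2" "v_bnd n (i + 1) = 1/2"
        using i ny by (auto simp: D_comb_half_triangle v_bnd_half)
      ultimately have "\<gamma> \<le> e_env half_triangle (x i) (x (i + 1))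
          + e_env ({0..1/2} \<times> {0..1/2}) (y i) (y (i + 1))"
        by (simp only: eq)
      moreover have b: "x i \<in> {0..1/2} \<and> y i \<in> {0..1/2}"
        "x (i + 1) \<in> {0..1/2} \<and> y (i + 1) \<in> {0..1/2}"
        using i bnds[of i] bnds[of "i + 1"] by auto
      moreover have "e_env half_triangle (x i) (x (i + 1)) = (x (i + 1) - x i) / 2"
        using b le by (intro e_env_half_triangle) (auto simp: half_triangle_def)
      moreover have "e_env ({0..1/2} \<times> {0..1/2}) (y i) (y (i + 1)) \<le> 1/4"
        using b by (intro e_env_half_square_le) auto
      ultimately have "\<gamma> \<le> (x (i + 1) - x i) / 2 + 1/4" by linarith
      then show ?thesis by (simp add: field_simps)
    qed
    from le_of_increments[where x = x, OF this]
    have "real m * (2 * \<gamma> - 1/2) \<le> x (m + 1) - x 1" .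
    also have "\<dots> \<le> 1/2" using bnds[of 1] bnds[of "m + 1"] by simp
    finally show "\<gamma> \<le> 1/4 * (1 + 1 / real m)"
      using m by (simp add: field_simps)
  qed
qed

theorem proposition1:
  shows "(\<forall>n\<ge>2. is_optimal_value (TW n) 2) \<and>
         (\<forall>n\<ge>5. is_optimal_value (TWbnd n) (1/2)) \<and>
         (\<forall>n\<ge>2. is_optimal_value (TWord n) (1 + 1 / (real n - 1))) \<and>
         (\<forall>n\<ge>5. is_optimal_value (TWcomb n) (1/4 * (1 + 1 / real_of_int \<lfloor>(real n - 1) / 4\<rfloor>)))"
  using TW_optimal TWbnd_optimal TWord_optimal TWcomb_optimal by blast

end
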